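(* Let $V$ be a finite dimensional pure odd vector space over $\mathbb K$ ($\mathbb K=\mathbb R$ or $\mathbb C$), let $n\ge2$ be even, and let $\mu$ be a symmetric (in the super sense, i.e. alternating in the ordinary sense) $n$-ary algebra structure on $V$. Let $\varphi$ be a symmetric (in the super sense, i.e. skew-symmetric in the ordinary sense) bilinear form on $V$. Then $(V,\mu)$ is quasi-Frobenius with respect to $\varphi$ if and only if the maximal isotropic subspace $$B_\varphi=\{a+\varphi(a,-)\mid a\in V\}\subset V\oplus V^*$$ is a subalgebra of $(V\oplus V^*,\mu^T)$. In other words, $\varphi\mapsto B_\varphi$ is a one-to-one correspondence between quasi-Frobenius structures on $(V,\mu)$ and maximal isotropic subalgebras of $(V\oplus V^*,\mu^T)$ that are transversal to $V^*$.
   Context: $(V,\mu)$ is quasi-Frobenius with respect to $\varphi$ (and $\varphi$ is a quasi-Frobenius structure on $(V,\mu)$) if $\sum_{cycl}\varphi(a_1,\mu(a_2,\ldots,a_{n+1}))=0$ for all $a_1,\ldots,a_{n+1}\in V$, where the sum is over all cyclic permutations of $(a_1,\ldots,a_{n+1})$. Non-degeneracy of $\varphi$ is not required. The $T_0^*$-extension $(V\oplus V^*,\mu^T)$ is the $n$-ary algebra on the pure odd space $V\oplus V^*$ with alternating multiplication $\mu^T$ determined by: $\mu^T(a_1,\ldots,a_n)=\mu(a_1,\ldots,a_n)$ for $a_i\in V$; $\mu^T$ vanishes when at least two arguments lie in $V^*$; and for $a_1,\ldots,a_{n-1}\in V$, $b^*\in V^*$, the element $\mu^T(a_1,\ldots,a_{n-1},b^*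 )\in V^*$ is given by $\mu^T(a_1,\ldots,a_{n-1},b^* )(c)=-b^*(\mu(a_1,\ldots,a_{n-1},c))$ for $c\in V$. Isotropy is with respect to the pairing on $V\oplus V^*$ given by $(a,\alpha)=(\alpha,a)=\alpha(a)$ for $a\in V$, $\alpha\in V^*$, with $(V,V)=0=(V^*,V^* )$. A maximal isotropic subspace $B$ is transversal to $V^*$ if $B\cap V^*=0$. A subalgebra is a subspace closed under $\mu^T$. *)

theory Defs
  imports Complex_Main "HOL-Library.Function_Algebras" "HOL-Analysis.Product_Vector"
begin

section \<open>The base field\<close>

class real_or_complex = field +
  assumes real_or_complex:
    "(\<exists>f :: 'a \<Rightarrow> real. bij f \<and> (\<forall>x y. f (x + y) = f x + f y \<and> f (x * y) = f x * f y)) \<or>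
     (\<exists>f :: 'a \<Rightarrow> complex. bij f \<and> (\<forall>x y. f (x + y) = f x + f y \<and> f (x * y) = f x * f y))"

instance real :: real_or_complex
  by standard (rule disjI1, rule exI[of _ id], simp)

instance complex :: real_or_complex
  by standard (rule disjI2, rule exI[of _ id], simp)


section \<open>Alternating n-ary algebras\<close>

text \<open>Tuples of arguments are lists of length \<open>n\<close>; values of \<open>m\<close> on lists of other lengths,
  or with entries outside the carrier \<open>W\<close>, are irrelevant. On a purely odd space, symmetry in
  the super sense is ordinary alternation, so no parity data are carried along.\<close>

definition nary_closed :: "nat \<Rightarrow> 'w set \<Rightarrow> ('w list \<Rightarrow> 'w) \<Rightarrow> bool" where
  "nary_closed n W m \<longleftrightarrow> (\<forall>xs. length xs = n \<and> set xs \<subseteq> W \<longrightarrow> m xs \<in> W)"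

definition nary_multilinear ::
  "('k \<Rightarrow> 'w::ab_group_add \<Rightarrow> 'w) \<Rightarrow> nat \<Rightarrow> 'w set \<Rightarrow> ('w list \<Rightarrow> 'w) \<Rightarrow> bool" where
  "nary_multilinear s n W m \<longleftrightarrow>
     (\<forall>xs i. length xs = n \<and> set xs \<subseteq> W \<and> i < n \<longrightarrow>
        (\<forall>x\<in>W. \<forall>y\<in>W. m (xs[i := x + y]) = m (xs[i := x]) + m (xs[i := y])) \<and>
        (\<forall>c. \<forall>x\<in>W. m (xs[i := s c x]) = s c (m (xs[i := x]))))"

definition nary_alternating :: "nat \<Rightarrow> 'w::ab_group_add set \<Rightarrow> ('w list \<Rightarrow> 'w) \<Rightarrow> bool" where
  "nary_alternating n W m \<longleftrightarrow>
     (\<forall>xs i j. length xs = n \<and> set xs \<subseteq> W \<and> i < j \<and> j < n \<and> xs ! i = xs ! j \<longrightarrow> m xs = 0)"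

definition alternating_algebra ::
  "('k \<Rightarrow> 'w::ab_group_add \<Rightarrow> 'w) \<Rightarrow> nat \<Rightarrow> 'w set \<Rightarrow> ('w list \<Rightarrow> 'w) \<Rightarrow> bool" where
  "alternating_algebra s n W m \<longleftrightarrow>
     nary_closed n W m \<and> nary_multilinear s n W m \<and> nary_alternating n W m"


section \<open>Quasi-Frobenius structures\<close>

definition skew_bilinear_form ::
  "('k::field \<Rightarrow> 'v::ab_group_add \<Rightarrow> 'v) \<Rightarrow> ('v \<Rightarrow> 'v \<Rightarrow> 'k) \<Rightarrow> bool" where
  "skew_bilinear_form s \<phi> \<longleftrightarrow>
     (\<forall>a. Vector_Spaces.linear s (*) (\<lambda>b. \<phi> a b)) \<and>
     (\<forall>b. Vector_Spaces.linear s (*) (\<lambda>a. \<phi> a b)) \<and>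
     (\<forall>a b. \<phi> a b = - \<phi> b a)"

definition quasi_Frobenius ::
  "nat \<Rightarrow> ('v list \<Rightarrow> 'v) \<Rightarrow> ('v \<Rightarrow> 'v \<Rightarrow> 'k::field) \<Rightarrow> bool" where
  "quasi_Frobenius n \<mu> \<phi> \<longleftrightarrow>
     (\<forall>as. length as = n + 1 \<longrightarrow>
        (\<Sum>k<n + 1. \<phi> (hd (rotate k as)) (\<mu> (tl (rotate k as)))) = 0)"


section \<open>The space V + V* and its pairing\<close>

text \<open>\<open>V\<close> is the whole type \<open>'v\<close>, \<open>V*\<close> is a subspace of the function type \<open>'v \<Rightarrow> 'k\<close>.
  Accordingly \<open>V \<oplus> V*\<close> is a subspace of the vector space \<open>'v \<times> ('v \<Rightarrow> 'k)\<close>.\<close>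

definition dual :: "('k::field \<Rightarrow> 'v::ab_group_add \<Rightarrow> 'v) \<Rightarrow> ('v \<Rightarrow> 'k) set" where
  "dual s = {\<alpha>. Vector_Spaces.linear s (*) \<alpha>}"

definition double_scale ::
  "('k::field \<Rightarrow> 'v::ab_group_add \<Rightarrow> 'v) \<Rightarrow> 'k \<Rightarrow> 'v \<times> ('v \<Rightarrow> 'k) \<Rightarrow> 'v \<times> ('v \<Rightarrow> 'k)" where
  "double_scale s = module_prod.scale s (\<lambda>c \<alpha> v. c * \<alpha> v)"

definition double :: "('k::field \<Rightarrow> 'v::ab_group_add \<Rightarrow> 'v) \<Rightarrow> ('v \<times> ('v \<Rightarrow> 'k)) set" where
  "double s = UNIV \<times> dual s"

definition in_V :: "'v \<Rightarrow> 'v \<times> ('v \<Rightarrow> 'k::field)" where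
  "in_V a = (a, 0)"

definition in_dual :: "('v \<Rightarrow> 'k::field) \<Rightarrow> 'v::ab_group_add \<times> ('v \<Rightarrow> 'k)" where
  "in_dual \<alpha> = (0, \<alpha>)"

definition pairing :: "'v \<times> ('v \<Rightarrow> 'k::field) \<Rightarrow> 'v \<times> ('v \<Rightarrow> 'k) \<Rightarrow> 'k" where
  "pairing x y = snd y (fst x) + snd x (fst y)"

definition isotropic_subspace ::
  "('k::field \<Rightarrow> 'v::ab_group_add \<Rightarrow> 'v) \<Rightarrow> ('v \<times> ('v \<Rightarrow> 'k)) set \<Rightarrow> bool" where
  "isotropic_subspace s B \<longleftrightarrow>
     module.subspace (double_scale s) B \<and> B \<subseteq> double s \<and> (\<forall>x\<in>B. \<forall>y\<in>B. pairing x y = 0)"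

definition maximal_isotropic ::
  "('k::field \<Rightarrow> 'v::ab_group_add \<Rightarrow> 'v) \<Rightarrow> ('v \<times> ('v \<Rightarrow> 'k)) set \<Rightarrow> bool" where
  "maximal_isotropic s B \<longleftrightarrow>
     isotropic_subspace s B \<and> (\<forall>C. isotropic_subspace s C \<and> B \<subseteq> C \<longrightarrow> C = B)"

definition transversal_to_dual ::
  "('k::field \<Rightarrow> 'v::ab_group_add \<Rightarrow> 'v) \<Rightarrow> ('v \<times> ('v \<Rightarrow> 'k)) set \<Rightarrow> bool" where
  "transversal_to_dual s B \<longleftrightarrow> B \<inter> in_dual ` dual s = {0}"

definition subalgebra ::
  "('k::field \<Rightarrow> 'v::ab_group_add \<Rightarrow> 'v) \<Rightarrow> nat \<Rightarrow>
    (('v \<times> ('v \<Rightarrow> 'k)) list \<Rightarrow> 'v \<times> ('v \<Rightarrow> 'k)) \<Rightarrow> ('v \<times> ('v \<Rightarrow> 'k)) set \<Rightarrow> bool" where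
  "subalgebra s n m B \<longleftrightarrow>
     module.subspace (double_scale s) B \<and> B \<subseteq> double s \<and> nary_closed n B m"

definition graph_of_form :: "('v \<Rightarrow> 'v \<Rightarrow> 'k::field) \<Rightarrow> ('v \<times> ('v \<Rightarrow> 'k)) set" where
  "graph_of_form \<phi> = {(a, \<phi> a) | a. True}"


section \<open>The extension of the multiplication to V + V*\<close>

text \<open>The defining properties determine \<open>M\<close> on the \<open>n\<close>-tuples of \<open>V \<oplus> V*\<close>; see
  \<open>T0_extension_T0_mult\<close> and \<open>T0_extension_unique\<close> below.\<close>

definition T0_extension ::
  "('k::field \<Rightarrow> 'v::ab_group_add \<Rightarrow> 'v) \<Rightarrow> nat \<Rightarrow> ('v list \<Rightarrow> 'v) \<Rightarrow>
    (('v \<times> ('v \<Rightarrow> 'k)) list \<Rightarrow> 'v \<times> ('v \<Rightarrow> 'k)) \<Rightarrow> bool" where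
  "T0_extension s n \<mu> M \<longleftrightarrow>
     alternating_algebra (double_scale s) n (double s) M \<and>
     (\<forall>as. length as = n \<longrightarrow> M (map in_V as) = in_V (\<mu> as)) \<and>
     (\<forall>xs i j. length xs = n \<and> set xs \<subseteq> double s \<and> i < j \<and> j < n \<and>
        xs ! i \<in> in_dual ` dual s \<and> xs ! j \<in> in_dual ` dual s \<longrightarrow> M xs = 0) \<and>
     (\<forall>as. \<forall>\<beta>\<in>dual s. length as + 1 = n \<longrightarrow>
        M (map in_V as @ [in_dual \<beta>]) = in_dual (\<lambda>c. - \<beta> (\<mu> (as @ [c]))))"

definition T0_mult ::
  "nat \<Rightarrow> ('v list \<Rightarrow> 'v) \<Rightarrow> ('v \<times> ('v \<Rightarrow> 'k::field)) list \<Rightarrow> 'v \<times> ('v \<Rightarrow> 'k)" where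
  "T0_mult n \<mu> xs =
     (\<mu> (map fst xs), \<lambda>c. - (\<Sum>i<n. snd (xs ! i) (\<mu> ((map fst xs)[i := c]))))"


lemma double_scale_Pair [simp]:
  assumes "vector_space s"
  shows "double_scale s c (a, \<alpha>) = (s c a, \<lambda>v. c * \<alpha> v)"
proof -
  interpret vector_space s by fact
  interpret f: vector_space "\<lambda>c \<alpha> (v::'b). c * \<alpha> v"
    by unfold_locales (auto simp: algebra_simps fun_eq_iff)
  interpret module_prod s "\<lambda>c \<alpha> (v::'b). c * \<alpha> v"
    by unfold_locales
  show ?thesis by (simp add: double_scale_def scale_prod)
qed

lemma vector_space_double_scale:
  assumes "vector_space s"
  shows "vector_space (double_scale s)"
proof -
  interpret vector_space s by fact
  interpret f: vector_space "\<lambda>c \<alpha> (v::'b). c * \<alpha> v"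
    by unfold_locales (auto simp: algebra_simps fun_eq_iff)
  interpret vector_space_prod s "\<lambda>c \<alpha> (v::'b). c * \<alpha> v"
    by unfold_locales
  show ?thesis unfolding double_scale_def by (rule p.vector_space_axioms)
qed

lemma vector_space_self: "vector_space ((*) :: 'k::field \<Rightarrow> 'k \<Rightarrow> 'k)"
  by unfold_locales (auto simp: algebra_simps)

lemma mem_dual_iff:
  assumes "vector_space s"
  shows "\<alpha> \<in> dual s \<longleftrightarrow> (\<forall>x y. \<alpha> (x + y) = \<alpha> x + \<alpha> y) \<and> (\<forall>c x. \<alpha> (s c x) = c * \<alpha> x)"
  unfolding dual_def
  using assms vector_space_self
  by (auto simp: Vector_Spaces.linear_def module_hom_def module_hom_axioms_def
      vector_space_def module_def algebra_simps)

lemma subspace_double: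
  assumes "vector_space s"
  shows "module.subspace (double_scale s) (double s)"
proof -
  interpret d: vector_space "double_scale s" by (rule vector_space_double_scale[OF assms])
  show ?thesis
    using assms unfolding d.subspace_def
    by (auto simp: double_def mem_dual_iff algebra_simps zero_prod_def)
qed

lemma nary_swap:
  assumes ml: "nary_multilinear s n W m" and alt: "nary_alternating n W m"
    and W: "\<And>x y. x \<in> W \<Longrightarrow> y \<in> W \<Longrightarrow> x + y \<in> W"
    and xs: "length xs = n" "set xs \<subseteq> W" and ij: "i \<noteq> j" "i < n" "j < n"
    and xy: "x \<in> W" "y \<in> W"
  shows "m (xs[i := x, j := y]) = - m (xs[i := y, j := x])"
proof -
  have len: "length (xs[k := z]) = n" for k z using xs by simp
  have sub: "set (xs[k := z]) \<subseteq> W" if "z \<in> W" for k z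
    using that xs set_update_subset_insert by fast
  have z: "m (xs[i := z, j := z]) = 0" if "z \<in> W" for z
  proof -
    have "set (xs[i := z, j := z]) \<subseteq> W"
      using that sub set_update_subset_insert by fast
    moreover have "xs[i := z, j := z] ! i = xs[i := z, j := z] ! j"
      using ij xs by (simp add: nth_list_update)
    ultimately show ?thesis
      using alt ij xs unfolding nary_alternating_def
      by (metis length_list_update nat_neq_iff)
  qed
  have a1: "m (xs[i := w, j := x + y]) = m (xs[i := w, j := x]) + m (xs[i := w, j := y])"
    if "w \<in> W" for w
    using ml len sub[OF that] ij xy unfolding nary_multilinear_def by blast
  have a2: "m (xs[i := x + y, j := w]) = m (xs[i := x, j := w]) + m (xs[i := y, j := w])"
    if "w \<in> W" for w
    using ml len sub[OF that] ij xy unfolding nary_multilinear_def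
    by (simp add: list_update_swap[OF ij(1)])
  have "0 = m (xs[i := x + y, j := x + y])" using z W xy by simp
  also have "\<dots> = m (xs[i := x, j := x]) + m (xs[i := y, j := x])
      + (m (xs[i := x, j := y]) + m (xs[i := y, j := y]))"
    using a1[OF W[OF xy]] a2[OF xy(1)] a2[OF xy(2)] by simp
  finally have "m (xs[i := y, j := x]) + m (xs[i := x, j := y]) = 0"
    using z xy by simp
  then show ?thesis by (simp add: eq_neg_iff_add_eq_0 add.commute)
qed

lemma T0_extension_unique:
  assumes vs: "vector_space s" and n: "n \<ge> 1"
    and M: "T0_extension s n \<mu> M" and M': "T0_extension s n \<mu> M'"
    and xs: "length xs = n" "set xs \<subseteq> double s"
  shows "M xs = M' xs"
proof -
  let ?V = "range in_V :: ('b \<times> ('b \<Rightarrow> 'a)) set"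
  let ?D = "in_dual ` dual s"
  interpret d: vector_space "double_scale s" by (rule vector_space_double_scale[OF vs])
  have z: "0 \<in> dual s" by (simp add: mem_dual_iff[OF vs])
  have VW: "?V \<subseteq> double s" and DW: "?D \<subseteq> double s"
    using z by (auto simp: double_def in_V_def in_dual_def)
  have W: "x + y \<in> double s" if "x \<in> double s" "y \<in> double s" for x y
    using subspace_double[OF vs] that by (rule d.subspace_add)
  have ml: "nary_multilinear (double_scale s) n (double s) N"
    and alt: "nary_alternating n (double s) N" if "T0_extension s n \<mu> N" for N
    using that by (auto simp: T0_extension_def alternating_algebra_def)
  have last: "M xs = M' xs"
    if len: "length xs = n" "\<forall>i<n - 1. xs ! i \<in> ?V" and xl: "xs ! (n - 1) \<in> ?D" for xs
  proof -
    obtain \<beta> where \<beta>: "\<beta> \<in> dual s" "xs ! (n - 1) = in_dual \<beta>" using xl by blast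
    have "xs = map in_V (map fst (butlast xs)) @ [in_dual \<beta>]"
    proof (rule nth_equalityI)
      fix i assume i: "i < length xs"
      show "xs ! i = (map in_V (map fst (butlast xs)) @ [in_dual \<beta>]) ! i"
      proof (cases "i < n - 1")
        case True
        then have "xs ! i \<in> ?V" using that by simp
        then show ?thesis using True that(1)
          by (auto simp: nth_append nth_butlast in_V_def)
      next
        case False
        then have "i = n - 1" using i that(1) by simp
        then show ?thesis using \<beta> that(1) by (simp add: nth_append)
      qed
    qed (use that n in simp)
    moreover have "length (map fst (butlast xs)) + 1 = n" using that n by simp
    ultimately show ?thesis
      using M M' \<beta>(1) unfolding T0_extension_def by metis
  qed
  have pure: "M xs = M' xs" if xs: "length xs = n" "set xs \<subseteq> double s" "\<forall>i<n. xs ! i \<in> ?V \<union> ?D" for xs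
  proof (cases "\<exists>i<n. xs ! i \<in> ?D")
    case False
    then have "\<forall>i<n. xs ! i \<in> ?V" using xs by auto
    then have "xs = map in_V (map fst xs)"
      using xs(1) by (intro nth_equalityI) (auto simp: in_V_def)
    then show ?thesis
      using M M' xs(1) unfolding T0_extension_def by (metis length_map)
  next
    case True
    then obtain i where i: "i < n" "xs ! i \<in> ?D" by blast
    show ?thesis
    proof (cases "\<exists>j<n. j \<noteq> i \<and> xs ! j \<in> ?D")
      case True
      then obtain j where j: "j < n" "j \<noteq> i" "xs ! j \<in> ?D" by blast
      then obtain k l where "k < l" "l < n" "xs ! k \<in> ?D" "xs ! l \<in> ?D"
        using i by (metis nat_neq_iff)
      then show ?thesis
        using M M' xs unfolding T0_extension_def by metis
    next
      case False
      then have V: "xs ! j \<in> ?V" if "j < n" "j \<noteq> i" for j using that xs by auto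
      show ?thesis
      proof (cases "i = n - 1")
        case True
        then show ?thesis using last[of xs] V i xs by auto
      next
        case False
        let ?ys = "xs[i := xs ! (n - 1), n - 1 := xs ! i]"
        have mem: "xs ! i \<in> double s" "xs ! (n - 1) \<in> double s"
          using xs i n by (auto dest: nth_mem)
        have swap: "N xs = - N ?ys" if "T0_extension s n \<mu> N" for N
          using nary_swap[OF ml alt W xs(1,2) False _ _ mem, OF that that] i n by simp
        have "M ?ys = M' ?ys"
          by (rule last) (use V False i n xs in \<open>auto simp: nth_list_update\<close>)
        then show ?thesis using swap[OF M] swap[OF M'] by metis
      qed
    qed
  qed
  have "\<forall>xs. length xs = n \<and> set xs \<subseteq> double s \<and> (\<forall>i<n. j \<le> i \<longrightarrow> xs ! i \<in> ?V \<union> ?D)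
      \<longrightarrow> M xs = M' xs" if "j \<le> n" for j
    using that
  proof (induction j)
    case 0
    then show ?case using pure by simp
  next
    case (Suc j)
    show ?case
    proof (intro allI impI)
      fix xs assume xs: "length xs = n \<and> set xs \<subseteq> double s \<and>
        (\<forall>i<n. Suc j \<le> i \<longrightarrow> xs ! i \<in> ?V \<union> ?D)"
      have j: "j < n" using Suc.prems by simp
      obtain a \<alpha> where a: "xs ! j = (a, \<alpha>)" by force
      have "xs ! j \<in> double s" using xs j by auto
      then have \<alpha>: "\<alpha> \<in> dual s" using a by (simp add: double_def)
      have mem: "in_V a \<in> double s" "in_dual \<alpha> \<in> double s" using VW DW \<alpha> by auto
      have "xs = xs[j := in_V a + in_dual \<alpha>]"
        using a by (metis (no_types, lifting) add.left_neutral add.right_neutral add_Pair in_V_def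
            in_dual_def list_update_id)
      then have dec: "N xs = N (xs[j := in_V a]) + N (xs[j := in_dual \<alpha>])"
        if "T0_extension s n \<mu> N" for N
        using ml[OF that] xs j mem unfolding nary_multilinear_def by metis
      have "M (xs[j := w]) = M' (xs[j := w])" if "w \<in> ?V \<union> ?D" for w
      proof -
        have "w \<in> double s" using that VW DW by auto
        then have "set (xs[j := w]) \<subseteq> double s"
          using xs set_update_subset_insert by fast
        moreover have "\<forall>i<n. j \<le> i \<longrightarrow> xs[j := w] ! i \<in> ?V \<union> ?D"
          using xs that j by (auto simp: nth_list_update)
        ultimately show ?thesis using Suc xs by simp
      qed
      then show "M xs = M' xs"
        using dec[OF M] dec[OF M'] \<alpha> by simp
    qed
  qed
  from this[of n] show ?thesis using xs by simp
qed

lemma T0_extension_T0_mult: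
  assumes vs: "vector_space s" and alg: "alternating_algebra s n UNIV \<mu>"
  shows "T0_extension s n \<mu> (T0_mult n \<mu>)"
proof -
  have add: "\<mu> (as[i := x + y]) = \<mu> (as[i := x]) + \<mu> (as[i := y])"
    and scale: "\<mu> (as[i := s c x]) = s c (\<mu> (as[i := x]))"
    if "length as = n" "i < n" for as i x y c
    using alg that by (auto simp: alternating_algebra_def nary_multilinear_def)
  have ml: "nary_multilinear s n UNIV \<mu>" and alt: "nary_alternating n UNIV \<mu>"
    using alg by (auto simp: alternating_algebra_def)
  have eq0: "\<mu> as = 0" if "length as = n" "i < n" "j < n" "i \<noteq> j" "as ! i = as ! j" for as i j
    using alt that unfolding nary_alternating_def by (metis nat_neq_iff subset_UNIV)
  have dl: "\<alpha> (x + y) = \<alpha> x + \<alpha> y" "\<alpha> (s c x) = c * \<alpha> x" if "\<alpha> \<in> dual s" for \<alpha> x y c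
    using that mem_dual_iff[OF vs] by auto
  have d0: "\<alpha> 0 = 0" "\<alpha> (- x) = - \<alpha> x" if "\<alpha> \<in> dual s" for \<alpha> x
  proof -
    show 0: "\<alpha> 0 = 0" using dl(1)[OF that, of 0 0] by (metis add.right_neutral add_left_cancel)
    show "\<alpha> (- x) = - \<alpha> x" using dl(1)[OF that, of x "- x"] 0
      by (simp add: eq_neg_iff_add_eq_0 add.commute)
  qed
  have D: "snd (xs ! i) \<in> dual s" if "set xs \<subseteq> double s" "i < length xs" for xs i
    using nth_mem[OF that(2)] that(1) by (auto simp: double_def)
  have mu0: "\<mu> (as[j := 0]) = 0" if "length as = n" "j < n" for as j
    using add[OF that, of 0 0] by simp
  have closed: "nary_closed n (double s) (T0_mult n \<mu>)"
    unfolding nary_closed_def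
  proof (intro allI impI)
    fix xs assume xs: "length xs = n \<and> set xs \<subseteq> double s"
    have "(\<lambda>c. - (\<Sum>i<n. snd (xs ! i) (\<mu> ((map fst xs)[i := c])))) \<in> dual s"
      unfolding mem_dual_iff[OF vs]
      using xs add scale dl[OF D]
      by (auto simp: sum.distrib sum_distrib_left)
    then show "T0_mult n \<mu> xs \<in> double s" by (simp add: T0_mult_def double_def)
  qed
  have upd: "as[k := a, i := c] = as[i := c, k := a]" if "i \<noteq> k" for as :: "'b list" and k i a c
    using that by (rule list_update_swap[symmetric])
  have multi: "nary_multilinear (double_scale s) n (double s) (T0_mult n \<mu>)"
    unfolding nary_multilinear_def
  proof (intro allI impI conjI ballI)
    fix xs k x y
    assume xs: "length xs = n \<and> set xs \<subseteq> double s \<and> k < n"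
      and x: "x \<in> double s" and y: "y \<in> double s"
    have "snd (xs[k := x + y] ! i) (\<mu> ((map fst (xs[k := x + y]))[i := c])) =
        snd (xs[k := x] ! i) (\<mu> ((map fst (xs[k := x]))[i := c])) +
        snd (xs[k := y] ! i) (\<mu> ((map fst (xs[k := y]))[i := c]))" if "i < n" for i c
      using xs that
      by (cases "i = k") (simp_all add: map_update upd[of i k] add dl[OF D] algebra_simps)
    then show "T0_mult n \<mu> (xs[k := x + y]) = T0_mult n \<mu> (xs[k := x]) + T0_mult n \<mu> (xs[k := y])"
      using xs by (simp add: T0_mult_def map_update add fun_eq_iff sum.distrib)
  next
    fix xs k c x
    assume xs: "length xs = n \<and> set xs \<subseteq> double s \<and> k < n" and x: "x \<in> double s"
    have sc: "fst (double_scale s c x) = s c (fst x)" "snd (double_scale s c x) v = c * snd x v" for v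
      using vs by (cases x; simp)+
    have "snd (xs[k := double_scale s c x] ! i) (\<mu> ((map fst (xs[k := double_scale s c x]))[i := v])) =
        c * snd (xs[k := x] ! i) (\<mu> ((map fst (xs[k := x]))[i := v]))" if "i < n" for i v
      using xs that
      by (cases "i = k") (simp_all add: map_update upd[of i k] scale dl[OF D] sc)
    then show "T0_mult n \<mu> (xs[k := double_scale s c x]) = double_scale s c (T0_mult n \<mu> (xs[k := x]))"
      using xs vs by (simp add: T0_mult_def map_update scale sc fun_eq_iff sum_distrib_left)
  qed
  have alter: "nary_alternating n (double s) (T0_mult n \<mu>)"
    unfolding nary_alternating_def
  proof (intro allI impI)
    fix xs i j
    assume xs: "length xs = n \<and> set xs \<subseteq> double s \<and> i < j \<and> j < n \<and> xs ! i = xs ! j"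
    let ?as = "map fst xs"
    let ?f = "\<lambda>c k. snd (xs ! k) (\<mu> (?as[k := c]))"
    have "\<mu> ?as = 0" by (rule eq0[of _ i j]) (use xs in auto)
    moreover have "(\<Sum>k<n. ?f c k) = 0" for c
    proof -
      have "?f c k = 0" if "k < n" "k \<noteq> i" "k \<noteq> j" for k
      proof -
        have "\<mu> (?as[k := c]) = 0" by (rule eq0[of _ i j]) (use xs that in auto)
        then show ?thesis using d0(1)[OF D] xs that by simp
      qed
      then have "(\<Sum>k<n. ?f c k) = (\<Sum>k\<in>{i, j}. ?f c k)"
        using xs by (intro sum.mono_neutral_right) auto
      also have "\<dots> = ?f c i + ?f c j" using xs by simp
      also have "?f c i = - ?f c j"
      proof -
        have a: "?as ! i = ?as ! j" using xs by simp
        have "?as[i := c] = ?as[i := c, j := ?as ! j]"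
          using xs by (metis list_update_id list_update_swap nat_neq_iff)
        moreover have "?as[j := c] = ?as[i := ?as ! j, j := c]"
          using a by (metis list_update_id)
        moreover have "\<mu> (?as[i := c, j := ?as ! j]) = - \<mu> (?as[i := ?as ! j, j := c])"
          by (rule nary_swap[OF ml alt]) (use xs in auto)
        ultimately show ?thesis using d0(2)[OF D] xs by simp
      qed
      finally show ?thesis by simp
    qed
    ultimately show "T0_mult n \<mu> xs = 0" by (simp add: T0_mult_def zero_prod_def fun_eq_iff)
  qed
  have onV: "T0_mult n \<mu> (map in_V as) = in_V (\<mu> as)" if "length as = n" for as
    using that by (simp add: T0_mult_def in_V_def fun_eq_iff o_def)
  have two: "T0_mult n \<mu> xs = 0"
    if xs: "length xs = n" "set xs \<subseteq> double s" "i < j" "j < n"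
      "xs ! i \<in> in_dual ` dual s" "xs ! j \<in> in_dual ` dual s" for xs i j
  proof -
    let ?as = "map fst xs"
    have 0: "?as ! i = 0" "?as ! j = 0" using xs by (auto simp: in_dual_def)
    have mu: "\<mu> as = 0" if "length as = n" "k < n" "as ! k = 0" for as k
      using mu0[OF that(1,2)] that(3) by (metis list_update_id)
    have "\<mu> ?as = 0" by (rule mu[of _ i]) (use xs 0 in auto)
    moreover have "\<mu> (?as[k := c]) = 0" if "k < n" for k c
    proof (cases "k = i")
      case True
      show ?thesis by (rule mu[of _ j]) (use xs 0 True in auto)
    next
      case False
      show ?thesis by (rule mu[of _ i]) (use xs 0 False in auto)
    qed
    ultimately show ?thesis
      using xs d0(1)[OF D] by (simp add: T0_mult_def zero_prod_def fun_eq_iff)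
  qed
  have one: "T0_mult n \<mu> (map in_V as @ [in_dual \<beta>]) = in_dual (\<lambda>c. - \<beta> (\<mu> (as @ [c])))"
    if "\<beta> \<in> dual s" "length as + 1 = n" for as \<beta>
  proof -
    let ?xs = "map in_V as @ [in_dual \<beta>]"
    have f: "map fst ?xs = as @ [0]" by (simp add: in_V_def in_dual_def o_def)
    have "\<mu> (as @ [0]) = 0"
      using mu0[of "as @ [0]" "length as"] that by simp
    moreover have "(\<Sum>i<n. snd (?xs ! i) (\<mu> ((as @ [0])[i := c]))) = \<beta> (\<mu> (as @ [c]))" for c
    proof -
      have "(\<Sum>i<n. snd (?xs ! i) (\<mu> ((as @ [0])[i := c]))) =
          (\<Sum>i<Suc (length as). snd (?xs ! i) (\<mu> ((as @ [0])[i := c])))"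
        using that by simp
      also have "\<dots> = \<beta> (\<mu> (as @ [c]))"
        by (simp add: nth_append in_V_def in_dual_def)
      finally show ?thesis .
    qed
    ultimately show ?thesis
      unfolding T0_mult_def f by (simp add: in_dual_def)
  qed
  show ?thesis
    unfolding T0_extension_def alternating_algebra_def
    using closed multi alter onV two one by blast
qed

end

theory Submission
  imports Defs
begin

text \<open>For $n$ even, $\mu(Y, c, X) = - \mu(X, c, Y)$ whenever $|X| + |Y| = n - 1$. Hence the cyclic sum
  for $(c, a_1, \ldots, a_n)$ vanishes iff $\varphi(c, \mu(a_1, \ldots, a_n))$ equals the sum of the
  $\varphi(a_i, \mu(a_1, \ldots, c, \ldots, a_n))$ with $c$ in place $i$, and this says that the product
  of the $a_i + \varphi(a_i, -)$ lies in $B_\varphi$ again. Conversely, if $B$ is maximal isotropic and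
  transversal to $V^*$, then a functional that vanishes on the projection of $B$ to $V$ is orthogonal
  to $B$, so it lies in $B$ by maximality and is zero by transversality. So $B$ projects onto $V$, and
  by transversality it is the graph of a map $V \to V^*$.\<close>

section \<open>Signs of reorderings of the arguments\<close>

lemma nary_swap_adjacent:
  assumes ml: "nary_multilinear s n UNIV m" and alt: "nary_alternating n UNIV m"
    and len: "length A + length B + 2 = n"
  shows "m (A @ x # y # B) = - m (A @ y # x # B)"
  using nary_swap[OF ml alt, of "A @ x # y # B" "length A" "Suc (length A)" x y] len
  by (simp add: list_update_append)

text \<open>The entry \<open>x\<close> passes the entries of \<open>B\<close> one at a time, and
  each adjacent swap costs a sign. The prefix \<open>A\<close> is generalised because it absorbs the
  entries already passed.\<close>

lemma nary_move:
  assumes ml: "nary_multilinear s n UNIV m" and alt: "nary_alternating n UNIV m"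
    and len: "length A + length B + length C + 1 = n"
  shows "m (A @ x # B @ C) = (if even (length B) then m (A @ B @ x # C) else - m (A @ B @ x # C))"
  using len
proof (induction B arbitrary: A)
  case (Cons b B)
  have "m (A @ x # (b # B) @ C) = - m ((A @ [b]) @ x # B @ C)"
    using nary_swap_adjacent[OF ml alt, of A "B @ C" x b] Cons.prems by simp
  then show ?case using Cons.IH[of "A @ [b]"] Cons.prems by simp
qed simp

text \<open>Carrying the first entry to the end crosses the other \<open>n - 1\<close> entries. This
  number is odd, so each entry of \<open>X\<close> contributes exactly one sign.\<close>

lemma nary_rotate_even:
  assumes ml: "nary_multilinear s n UNIV m" and alt: "nary_alternating n UNIV m"
    and len: "length X + length Y = n" and n: "even n"
  shows "m (X @ Y) = (if even (length X) then m (Y @ X) else - m (Y @ X))"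
  using len
proof (induction X arbitrary: Y)
  case (Cons x X)
  have "odd (length (X @ Y))" using Cons.prems n by auto
  then have "m ((x # X) @ Y) = - m (X @ Y @ [x])"
    using nary_move[OF ml alt, of "[]" "X @ Y" "[]" x] Cons.prems by simp
  then show ?case using Cons.IH[of "Y @ [x]"] Cons.prems by simp
qed simp

text \<open>Both sides are compared with \<open>m (X @ Y @ [c])\<close>: rotating
  \<open>Y @ [c]\<close> past \<open>X\<close> gives the sign of \<open>length Y + 1\<close>, moving
  \<open>c\<close> past \<open>Y\<close> the sign of \<open>length Y\<close>. The two parities
  always differ.\<close>

lemma nary_exchange_blocks:
  assumes ml: "nary_multilinear s n UNIV m" and alt: "nary_alternating n UNIV m"
    and len: "length X + length Y + 1 = n" and n: "even n"
  shows "m (Y @ c # X) = - m (X @ c # Y)"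
proof -
  have "m ((Y @ [c]) @ X) = (if even (length (Y @ [c])) then m (X @ Y @ [c]) else - m (X @ Y @ [c]))"
    by (rule nary_rotate_even[OF ml alt]) (use len n in auto)
  moreover have "m (X @ c # Y @ []) = (if even (length Y) then m (X @ Y @ [c]) else - m (X @ Y @ [c]))"
    using nary_move[OF ml alt, of X Y "[]" c] len by simp
  ultimately show ?thesis by simp
qed

section \<open>Skew forms and the cyclic sum\<close>

lemma skew_bilinear_form_iff:
  assumes "vector_space s"
  shows "skew_bilinear_form s \<phi> \<longleftrightarrow>
    (\<forall>a. \<phi> a \<in> dual s) \<and> (\<forall>a b. \<phi> (a + b) = \<phi> a + \<phi> b) \<and>
    (\<forall>c a. \<phi> (s c a) = (\<lambda>b. c * \<phi> a b)) \<and> (\<forall>a b. \<phi> a b = - \<phi> b a)"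
proof -
  have "skew_bilinear_form s \<phi> \<longleftrightarrow>
      (\<forall>a. \<phi> a \<in> dual s) \<and> (\<forall>b. (\<lambda>a. \<phi> a b) \<in> dual s) \<and> (\<forall>a b. \<phi> a b = - \<phi> b a)"
    by (simp only: skew_bilinear_form_def dual_def mem_Collect_eq)
  \<comment> \<open>Linearity in the first argument becomes linearity of \<open>\<phi>\<close> as a
    map from V to functions, the form in which closure of its graph under addition and scaling is
    checked.\<close>
  moreover have "(\<forall>b. (\<lambda>a. \<phi> a b) \<in> dual s) \<longleftrightarrow>
      (\<forall>a b. \<phi> (a + b) = \<phi> a + \<phi> b) \<and> (\<forall>c a. \<phi> (s c a) = (\<lambda>b. c * \<phi> a b))"
    unfolding mem_dual_iff[OF assms] by (auto simp: fun_eq_iff)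
  ultimately show ?thesis by blast
qed

lemma skew_bilinear_formD:
  assumes vs: "vector_space s" and \<phi>: "skew_bilinear_form s \<phi>"
  shows "\<phi> a \<in> dual s" "\<phi> (a + b) = \<phi> a + \<phi> b" "\<phi> (s c a) = (\<lambda>b. c * \<phi> a b)"
    "\<phi> a b = - \<phi> b a"
  using \<phi> unfolding skew_bilinear_form_iff[OF vs] by blast+

lemma quasi_Frobenius_iff:
  assumes ml: "nary_multilinear s n UNIV \<mu>" and alt: "nary_alternating n UNIV \<mu>" and n: "even n"
    and minus: "\<And>a b. \<phi> a (- b) = - \<phi> a b"
  shows "quasi_Frobenius n \<mu> \<phi> \<longleftrightarrow>
    (\<forall>as c. length as = n \<longrightarrow> \<phi> c (\<mu> as) = (\<Sum>i<n. \<phi> (as ! i) (\<mu> (as[i := c]))))"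
proof -
  have sum: "(\<Sum>k<n + 1. \<phi> (hd (rotate k (c # as))) (\<mu> (tl (rotate k (c # as))))) =
      \<phi> c (\<mu> as) - (\<Sum>i<n. \<phi> (as ! i) (\<mu> (as[i := c])))" if as: "length as = n" for as c
  proof -
    have "\<phi> (hd (rotate (Suc i) (c # as))) (\<mu> (tl (rotate (Suc i) (c # as)))) =
        - \<phi> (as ! i) (\<mu> (as[i := c]))" if i: "i < n" for i
    proof -
      \<comment> \<open>As \<open>Suc i\<close> is at most \<open>n\<close>, there is no
        wrap-around. The entry \<open>as ! i\<close> comes first, followed by the later entries,
        \<open>c\<close>, and the earlier entries; exchanging the two blocks around \<open>c\<close>
        puts \<open>c\<close> in place \<open>i\<close>.\<close>
      have "rotate (Suc i) (c # as) = drop i as @ c # take i as"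
        using i as by (simp only: rotate_drop_take) simp
      also have "\<dots> = as ! i # drop (Suc i) as @ c # take i as"
        using i as by (simp add: Cons_nth_drop_Suc[symmetric])
      finally have "rotate (Suc i) (c # as) = as ! i # drop (Suc i) as @ c # take i as" .
      moreover have "\<mu> (drop (Suc i) as @ c # take i as) = - \<mu> (take i as @ c # drop (Suc i) as)"
        by (rule nary_exchange_blocks[OF ml alt]) (use i as n in auto)
      moreover have "take i as @ c # drop (Suc i) as = as[i := c]"
        using i as by (simp add: upd_conv_take_nth_drop)
      ultimately show ?thesis by (simp add: minus)
    qed
    \<comment> \<open>The term \<open>k = 0\<close> is split off the sum, since it is the only one
      with \<open>c\<close> at the head. The deleted rules would split off the last term and unfold
      the rotations.\<close>
    then show ?thesis
      by (simp add: sum.lessThan_Suc_shift sum_negf del: rotate_Suc sum.lessThan_Suc)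
  qed
  have "quasi_Frobenius n \<mu> \<phi> \<longleftrightarrow> (\<forall>as c. length as = n \<longrightarrow>
      (\<Sum>k<n + 1. \<phi> (hd (rotate k (c # as))) (\<mu> (tl (rotate k (c # as))))) = 0)"
    unfolding quasi_Frobenius_def
    by (simp only: Suc_eq_plus1[symmetric] length_Suc_conv) blast
  also have "\<dots> \<longleftrightarrow> (\<forall>as c. length as = n \<longrightarrow>
      \<phi> c (\<mu> as) - (\<Sum>i<n. \<phi> (as ! i) (\<mu> (as[i := c]))) = 0)"
    using sum by (metis (no_types, lifting))
  finally show ?thesis by simp
qed

section \<open>The graph of a skew form as a maximal isotropic subspace\<close>

lemma mem_graph_of_form: "(a, \<alpha>) \<in> graph_of_form \<phi> \<longleftrightarrow> \<alpha> = \<phi> a"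
  by (auto simp: graph_of_form_def)

lemma inj_graph_of_form: "inj graph_of_form"
  by (rule injI, rule ext) (metis mem_graph_of_form)

lemma graph_of_form_subset_double:
  assumes "vector_space s" "skew_bilinear_form s \<phi>"
  shows "graph_of_form \<phi> \<subseteq> double s"
  using skew_bilinear_formD(1)[OF assms] by (auto simp: graph_of_form_def double_def)

lemma subspace_graph_of_form:
  assumes vs: "vector_space s" and \<phi>: "skew_bilinear_form s \<phi>"
  shows "module.subspace (double_scale s) (graph_of_form \<phi>)"
proof -
  interpret d: vector_space "double_scale s" by (rule vector_space_double_scale[OF vs])
  note add = skew_bilinear_formD(2)[OF assms] and scale = skew_bilinear_formD(3)[OF assms]
  have "\<phi> 0 = 0" using add[of 0 0] by simp
  then show ?thesis
    unfolding d.subspace_def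
    using vs by (auto simp: mem_graph_of_form add scale zero_prod_def)
qed

lemma maximal_isotropic_graph_of_form:
  assumes vs: "vector_space s" and \<phi>: "skew_bilinear_form s \<phi>"
  shows "maximal_isotropic s (graph_of_form \<phi>)"
proof -
  note skew = skew_bilinear_formD(4)[OF assms]
  have "pairing x y = 0" if "x \<in> graph_of_form \<phi>" "y \<in> graph_of_form \<phi>" for x y
    using that skew[of "fst x" "fst y"] by (auto simp: graph_of_form_def pairing_def)
  then have "isotropic_subspace s (graph_of_form \<phi>)"
    using subspace_graph_of_form[OF assms] graph_of_form_subset_double[OF assms]
    by (simp add: isotropic_subspace_def)
  moreover have "C \<subseteq> graph_of_form \<phi>" if C: "isotropic_subspace s C" "graph_of_form \<phi> \<subseteq> C" for C
  proof clarify
    fix a \<alpha> assume a: "(a, \<alpha>) \<in> C"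
    have "\<alpha> b = \<phi> a b" for b
    proof -
      \<comment> \<open>Orthogonality to \<open>(b, \<phi> b)\<close> reads
        \<open>\<phi> b a + \<alpha> b = 0\<close>; by skewness this fixes \<open>\<alpha> b\<close>
        as \<open>\<phi> a b\<close>.\<close>
      have "(b, \<phi> b) \<in> C" using C(2) by (auto simp: graph_of_form_def)
      then have "pairing (a, \<alpha>) (b, \<phi> b) = 0" using C(1) a by (auto simp: isotropic_subspace_def)
      then show ?thesis using skew[of a b] by (simp add: pairing_def add_eq_0_iff)
    qed
    then show "(a, \<alpha>) \<in> graph_of_form \<phi>" by (auto simp: mem_graph_of_form)
  qed
  ultimately show ?thesis by (auto simp: maximal_isotropic_def)
qed

lemma transversal_graph_of_form:
  assumes vs: "vector_space s" and \<phi>: "skew_bilinear_form s \<phi>"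
  shows "transversal_to_dual s (graph_of_form \<phi>)"
proof -
  have "\<phi> 0 = 0" using skew_bilinear_formD(2)[OF assms, of 0 0] by simp
  moreover have "0 \<in> dual s" by (simp add: mem_dual_iff[OF vs])
  ultimately show ?thesis
    by (auto simp: transversal_to_dual_def mem_graph_of_form in_dual_def zero_prod_def)
qed

section \<open>Closure of the graph under the extended multiplication\<close>

lemma T0_mult_mem_graph_of_form:
  assumes as: "length as = n"
  shows "T0_mult n \<mu> (map (\<lambda>a. (a, \<phi> a)) as) \<in> graph_of_form \<phi> \<longleftrightarrow>
    (\<forall>c. \<phi> (\<mu> as) c = - (\<Sum>i<n. \<phi> (as ! i) (\<mu> (as[i := c]))))"
proof -
  have "map fst (map (\<lambda>a. (a, \<phi> a)) as) = as" by (simp add: o_def)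
  moreover have "(\<Sum>i<n. snd (map (\<lambda>a. (a, \<phi> a)) as ! i) (\<mu> (as[i := c]))) =
      (\<Sum>i<n. \<phi> (as ! i) (\<mu> (as[i := c])))" for c
    using as by simp
  ultimately show ?thesis
    unfolding T0_mult_def mem_graph_of_form by (auto simp: fun_eq_iff)
qed

lemma subalgebra_graph_of_form_iff:
  assumes vs: "vector_space s" and n: "n \<ge> 1" "even n"
    and alg: "alternating_algebra s n UNIV \<mu>" and M: "T0_extension s n \<mu> M"
    and \<phi>: "skew_bilinear_form s \<phi>"
  shows "subalgebra s n M (graph_of_form \<phi>) \<longleftrightarrow> quasi_Frobenius n \<mu> \<phi>"
proof -
  have ml: "nary_multilinear s n UNIV \<mu>" and alt: "nary_alternating n UNIV \<mu>"
    using alg by (auto simp: alternating_algebra_def)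
  note skew = skew_bilinear_formD(4)[OF vs \<phi>]
  have add: "\<phi> a (b + c) = \<phi> a b + \<phi> a c" for a b c
    using skew_bilinear_formD(1)[OF vs \<phi>] mem_dual_iff[OF vs] by blast
  have minus: "\<phi> a (- b) = - \<phi> a b" for a b
    using add[of a b "- b"] add[of a 0 0] by (simp add: eq_neg_iff_add_eq_0 add.commute)
  let ?g = "\<lambda>a. (a, \<phi> a)"
  have tuples: "set xs \<subseteq> graph_of_form \<phi> \<longleftrightarrow> (\<exists>as. xs = map ?g as)" for xs
  proof
    assume "set xs \<subseteq> graph_of_form \<phi>"
    then have "xs = map ?g (map fst xs)"
      by (induction xs) (auto simp: graph_of_form_def)
    then show "\<exists>as. xs = map ?g as" ..
  qed (auto simp: graph_of_form_def)
  have "nary_closed n (graph_of_form \<phi>) M \<longleftrightarrow>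
      (\<forall>as. length as = n \<longrightarrow> M (map ?g as) \<in> graph_of_form \<phi>)"
    unfolding nary_closed_def tuples by (intro iffI allI impI) (blast intro: length_map[THEN trans], clarsimp)
  also have "\<dots> \<longleftrightarrow> (\<forall>as. length as = n \<longrightarrow> T0_mult n \<mu> (map ?g as) \<in> graph_of_form \<phi>)"
  proof -
    \<comment> \<open>The multiplication \<open>M\<close> is known only through its defining
      properties. They determine it on tuples from \<open>double s\<close>, so the explicit formula
      may replace it there.\<close>
    have "M (map ?g as) = T0_mult n \<mu> (map ?g as)" if "length as = n" for as
      by (rule T0_extension_unique[OF vs n(1) M T0_extension_T0_mult[OF vs alg]])
        (use that graph_of_form_subset_double[OF vs \<phi>] in \<open>auto simp: graph_of_form_def\<close>)
    then show ?thesis by simp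
  qed
  also have "\<dots> \<longleftrightarrow> (\<forall>as c. length as = n \<longrightarrow>
      \<phi> c (\<mu> as) = (\<Sum>i<n. \<phi> (as ! i) (\<mu> (as[i := c]))))"
  proof -
    have "\<phi> (\<mu> as) c = - x \<longleftrightarrow> \<phi> c (\<mu> as) = x" for as c x
      unfolding skew[of "\<mu> as" c] by (rule neg_equal_iff_equal)
    then show ?thesis by (simp add: T0_mult_mem_graph_of_form)
  qed
  also have "\<dots> \<longleftrightarrow> quasi_Frobenius n \<mu> \<phi>"
    by (rule quasi_Frobenius_iff[where s = s, symmetric]) (fact ml alt n(2) minus)+
  finally show ?thesis
    using subspace_graph_of_form[OF vs \<phi>] graph_of_form_subset_double[OF vs \<phi>]
    by (simp add: subalgebra_def)
qed

section \<open>From transversal maximal isotropic subspaces back to forms\<close>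

lemma ex_dual_vanishing_on_subspace:
  assumes vs: "vector_space s" and P: "module.subspace s P" and x: "x \<notin> P"
  shows "\<exists>\<alpha>\<in>dual s. (\<forall>p\<in>P. \<alpha> p = 0) \<and> \<alpha> x = 1"
proof -
  interpret vector_space_pair s "(*) :: 'a \<Rightarrow> 'a \<Rightarrow> 'a"
    using vs vector_space_self by (simp add: vector_space_pair_def)
  obtain B where B: "B \<subseteq> P" "vs1.independent B" "P \<subseteq> vs1.span B"
    by (rule vs1.maximal_independent_subset)
  have xB: "x \<notin> B" using B(1) x by blast
  have "vs1.span B \<subseteq> P" using B(1) P by (rule vs1.span_minimal)
  \<comment> \<open>Since \<open>B\<close> is a basis of \<open>P\<close> and \<open>x\<close> lies
    outside \<open>P\<close>, the values 1 at \<open>x\<close> and 0 on \<open>B\<close> can be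
    prescribed and extended linearly.\<close>
  then have "vs1.independent (insert x B)"
    using vs1.independent_insertI[of x B] B(2) x by blast
  from linear_independent_extend[OF this, of "\<lambda>y. if y = x then 1 else 0"]
  obtain g where g: "Vector_Spaces.linear s (*) g"
    "\<forall>y\<in>insert x B. g y = (if y = x then 1 else 0)" by blast
  have "g p = 0" if "p \<in> P" for p
  proof (rule linear_eq_0_on_span[OF g(1)])
    show "g y = 0" if "y \<in> B" for y using g(2) xB that by auto
    show "p \<in> vs1.span B" using B(3) that by blast
  qed
  then show ?thesis using g by (auto simp: dual_def)
qed

text \<open>Adjoining \<open>z\<close> to \<open>B\<close> keeps the span isotropic, so by
  maximality the span is \<open>B\<close> itself.\<close>

lemma maximal_isotropic_orthogonal_mem:
  assumes vs: "vector_space s" and B: "maximal_isotropic s B" and z: "z \<in> double s"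
    and zz: "pairing z z = 0" and zB: "\<And>x. x \<in> B \<Longrightarrow> pairing x z = 0"
  shows "z \<in> B"
proof -
  interpret d: vector_space "double_scale s" by (rule vector_space_double_scale[OF vs])
  have iso: "d.subspace B" "B \<subseteq> double s" "\<And>x y. x \<in> B \<Longrightarrow> y \<in> B \<Longrightarrow> pairing x y = 0"
    using B by (auto simp: maximal_isotropic_def isotropic_subspace_def)
  let ?C = "d.span (insert z B)"
  have sub: "?C \<subseteq> double s"
    using iso(2) z subspace_double[OF vs] by (intro d.span_minimal) auto
  have pair: "pairing (x + y) w = pairing x w + pairing y w"
      "pairing (double_scale s c x) w = c * pairing x w"
    if "w \<in> double s" for x y w c
    using that vs
    by (cases x; cases y; cases w; simp add: pairing_def double_def mem_dual_iff algebra_simps)+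
  have comm: "pairing x y = pairing y x" for x y :: "'b \<times> ('b \<Rightarrow> 'a)"
    by (simp add: pairing_def add.commute)
  have 0: "pairing 0 w = 0" if "w \<in> double s" for w
    using pair(2)[OF that, of 0 0] by simp
  have perp: "d.subspace {x. pairing x w = 0}" if "w \<in> double s" for w
    using pair[OF that] 0[OF that] by (auto simp: d.subspace_def)
  have gen: "pairing x w = 0" if "x \<in> insert z B" "w \<in> insert z B" for x w
    using that zz zB iso(3) comm by (metis insertE)
  \<comment> \<open>Orthogonality passes from generators to the span in one argument at a time: the
    vectors orthogonal to a fixed \<open>w\<close> form a subspace, and symmetry of the pairing then
    handles the other argument.\<close>
  have half: "pairing x w = 0" if x: "x \<in> ?C" and w: "w \<in> insert z B" for x w
  proof -
    have "w \<in> double s" using w z iso(2) by blast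
    then have "?C \<subseteq> {x. pairing x w = 0}"
      using gen w by (intro d.span_minimal perp subsetI CollectI)
    then show ?thesis using x by blast
  qed
  have "pairing x w = 0" if x: "x \<in> ?C" and w: "w \<in> ?C" for x w
  proof -
    have "pairing y w = 0" if "y \<in> insert z B" for y
      using half[OF w that] comm by metis
    then have "?C \<subseteq> {y. pairing y w = 0}"
      using w sub by (intro d.span_minimal perp subsetI CollectI) auto
    then show ?thesis using x by blast
  qed
  then have "isotropic_subspace s ?C"
    using sub by (simp add: isotropic_subspace_def)
  moreover have "B \<subseteq> ?C" using d.span_superset by blast
  ultimately have "?C = B" using B by (auto simp: maximal_isotropic_def)
  then show ?thesis using d.span_base[of z "insert z B"] by simp
qed

lemma maximal_isotropic_transversal_is_graph:
  assumes vs: "vector_space s" and B: "maximal_isotropic s B" and T: "transversal_to_dual s B"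
  shows "\<exists>\<phi>. skew_bilinear_form s \<phi> \<and> B = graph_of_form \<phi>"
proof -
  interpret v: vector_space s by fact
  interpret d: vector_space "double_scale s" by (rule vector_space_double_scale[OF vs])
  have sub: "d.subspace B" and BD: "B \<subseteq> double s"
    and iso: "\<And>x y. x \<in> B \<Longrightarrow> y \<in> B \<Longrightarrow> pairing x y = 0"
    using B by (auto simp: maximal_isotropic_def isotropic_subspace_def)
  have dual: "\<alpha> \<in> dual s" if "(a, \<alpha>) \<in> B" for a \<alpha>
    using that BD by (auto simp: double_def)
  have zero: "\<alpha> = 0" if "(0, \<alpha>) \<in> B" for \<alpha>
    using that T dual by (auto simp: transversal_to_dual_def in_dual_def zero_prod_def)
  \<comment> \<open>The difference of two elements of \<open>B\<close> over the same
    \<open>a\<close> lies in V*, where transversality leaves only zero.\<close>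
  have uniq: "\<alpha> = \<beta>" if "(a, \<alpha>) \<in> B" "(a, \<beta>) \<in> B" for a \<alpha> \<beta>
    using d.subspace_diff[OF sub that] zero[of "\<alpha> - \<beta>"] by simp
  have ex: "\<exists>\<alpha>. (x, \<alpha>) \<in> B" for x
  proof (rule ccontr)
    assume "\<nexists>\<alpha>. (x, \<alpha>) \<in> B"
    then have x: "x \<notin> fst ` B" by force
    have fst_scale: "fst (double_scale s c y) = s c (fst y)" for c y
      using vs by (cases y) simp
    have "v.subspace (fst ` B)"
      unfolding v.subspace_def
    proof (intro conjI allI ballI)
      show "0 \<in> fst ` B" using d.subspace_0[OF sub] by force
    next
      fix a b assume "a \<in> fst ` B" "b \<in> fst ` B"
      then obtain y z where "y \<in> B" "z \<in> B" "a = fst y" "b = fst z" by blast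
      then show "a + b \<in> fst ` B"
        using d.subspace_add[OF sub, of y z] by (intro image_eqI[of _ _ "y + z"]) simp_all
    next
      fix c a assume "a \<in> fst ` B"
      then obtain y where "y \<in> B" "a = fst y" by blast
      then show "s c a \<in> fst ` B"
        using d.subspace_scale[OF sub, of y c] fst_scale
        by (intro image_eqI[of _ _ "double_scale s c y"]) simp_all
    qed
    then obtain \<alpha> where \<alpha>: "\<alpha> \<in> dual s" "\<forall>p\<in>fst ` B. \<alpha> p = 0" "\<alpha> x = 1"
      using ex_dual_vanishing_on_subspace[OF vs _ x] by blast
    have \<alpha>0: "\<alpha> 0 = 0" using \<alpha>(2) d.subspace_0[OF sub] by force
    have "(0, \<alpha>) \<in> B"
    proof (rule maximal_isotropic_orthogonal_mem[OF vs B])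
      fix y assume y: "y \<in> B"
      then have "snd y \<in> dual s" using dual[of "fst y"] by simp
      \<comment> \<open>Homogeneity at the scalar 0 gives \<open>snd y 0 = 0\<close>, which removes
        the second term of the pairing; the first vanishes because \<open>\<alpha>\<close> kills the
        projection of \<open>B\<close>.\<close>
      then have "snd y (s 0 0) = 0 * snd y 0" using mem_dual_iff[OF vs] by blast
      then show "pairing y (0, \<alpha>) = 0" using \<alpha>(2) y by (simp add: pairing_def)
    qed (use \<alpha>(1) \<alpha>0 in \<open>auto simp: double_def pairing_def\<close>)
    then show False using zero \<alpha>(3) by fastforce
  qed
  from ex obtain \<phi> where \<phi>: "\<And>a. (a, \<phi> a) \<in> B" by metis
  have eq: "B = graph_of_form \<phi>"
    using \<phi> uniq by (auto simp: graph_of_form_def)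
  have "\<phi> (a + b) = \<phi> a + \<phi> b" for a b
    using d.subspace_add[OF sub \<phi>[of a] \<phi>[of b]] uniq[OF \<phi>] by simp
  moreover have "\<phi> (s c a) = (\<lambda>b. c * \<phi> a b)" for c a
    using d.subspace_scale[OF sub \<phi>[of a], of c] uniq[OF \<phi>] vs by simp
  \<comment> \<open>Isotropy of \<open>B\<close>, read on two graph points, is exactly
    skewness.\<close>
  moreover have "\<phi> a b = - \<phi> b a" for a b
    using iso[OF \<phi>[of a] \<phi>[of b]] by (simp add: pairing_def eq_neg_iff_add_eq_0 add.commute)
  ultimately have "skew_bilinear_form s \<phi>"
    using dual[OF \<phi>] unfolding skew_bilinear_form_iff[OF vs] by blast
  then show ?thesis using eq by blast
qed

theorem proposition11:
  fixes scale :: "'k::real_or_complex \<Rightarrow> 'v::ab_group_add \<Rightarrow> 'v"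
    and Basis :: "'v set"
    and n :: nat
    and \<mu> :: "'v list \<Rightarrow> 'v"
    and \<mu>T :: "('v \<times> ('v \<Rightarrow> 'k)) list \<Rightarrow> 'v \<times> ('v \<Rightarrow> 'k)"
  assumes "finite_dimensional_vector_space scale Basis"
    and "n \<ge> 2" and "even n"
    and "alternating_algebra scale n UNIV \<mu>"
    and "T0_extension scale n \<mu> \<mu>T"
  shows "(\<forall>\<phi>. skew_bilinear_form scale \<phi> \<longrightarrow>
            maximal_isotropic scale (graph_of_form \<phi>) \<and>
            (quasi_Frobenius n \<mu> \<phi> \<longleftrightarrow> subalgebra scale n \<mu>T (graph_of_form \<phi>))) \<and>
         bij_betw graph_of_form
           {\<phi>. skew_bilinear_form scale \<phi> \<and> quasi_Frobenius n \<mu> \<phi>}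
           {B. maximal_isotropic scale B \<and> subalgebra scale n \<mu>T B \<and> transversal_to_dual scale B}"
proof -
  interpret finite_dimensional_vector_space scale Basis by fact
  have vs: "vector_space scale" by (rule vector_space_axioms)
  note sub_iff = subalgebra_graph_of_form_iff[OF vs _ assms(3-5)]
  have n: "n \<ge> 1" using assms(2) by simp
  have "bij_betw graph_of_form
      {\<phi>. skew_bilinear_form scale \<phi> \<and> quasi_Frobenius n \<mu> \<phi>}
      {B. maximal_isotropic scale B \<and> subalgebra scale n \<mu>T B \<and> transversal_to_dual scale B}"
    (is "bij_betw _ ?F ?S")
  proof (rule bij_betw_imageI)
    show "inj_on graph_of_form ?F" using inj_graph_of_form by (rule inj_on_subset) simp
    show "graph_of_form ` ?F = ?S"
    proof (intro equalityI subsetI)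
      fix B assume "B \<in> ?S"
      \<comment> \<open>Maximality and transversality make \<open>B\<close> a graph; being a
        subalgebra then turns into the cyclic identity for its form.\<close>
      moreover from this obtain \<phi> where "skew_bilinear_form scale \<phi>" "B = graph_of_form \<phi>"
        using maximal_isotropic_transversal_is_graph[OF vs, of B] by blast
      ultimately show "B \<in> graph_of_form ` ?F" using sub_iff[OF n, of \<phi>] by simp
    next
      fix B assume "B \<in> graph_of_form ` ?F"
      then obtain \<phi> where "skew_bilinear_form scale \<phi>" "quasi_Frobenius n \<mu> \<phi>"
        "B = graph_of_form \<phi>" by blast
      then show "B \<in> ?S"
        using maximal_isotropic_graph_of_form[OF vs, of \<phi>] transversal_graph_of_form[OF vs, of \<phi>]
          sub_iff[OF n, of \<phi>] by simp
    qed
  qed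
  then show ?thesis
    using maximal_isotropic_graph_of_form[OF vs] sub_iff[OF n] by simp
qed

end
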